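(* Let $n>k\ge 1$ be natural numbers and let $\epsilon>0$. Then there exists $a_0$ such that for all $a>a_0$ with $a>0$ and all real $b$ with $0<b<\left(\frac{n-k}{n+k}-\epsilon\right)a$, the function $$f(z)=z^n+az^k+b\overline{z}^k-1,\qquad z\in\mathbb{C},$$ has exactly $n$ zeros in $\mathbb{C}$, counted with multiplicity.
   Context: Here $f=H+\overline{G}$ with analytic part $H(z)=z^n+az^k-1$ and co-analytic part $\overline{G(z)}$, $G(z)=bz^k$. The sense-preserving region of $f$ is $\{z: |H'(z)|>|G'(z)|\}$ and the sense-reversing region is $\{z: |H'(z)|<|G'(z)|\}$. The order of a zero $z_0$ of $f$ in the sense-preserving region is the smallest $m\ge 1$ with $H^{(m)}(z_0)\ne 0$; the order of a zero $z_0$ in the sense-reversing region is $-m$, where $m\ge1$ is the smallest integer with $G^{(m)}(z_0)\neq 0$. A zero is counted with multiplicity equal to the absolute value of its order. *)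

theory Defs
  imports "HOL-Complex_Analysis.Complex_Analysis"
begin

text \<open>Harmonic functions are decomposed as \<open>f = H + cnj \<circ> G\<close> with analytic part \<open>H\<close> and
  co-analytic part \<open>cnj \<circ> G\<close>.\<close>

definition sense_preserving_region :: "(complex \<Rightarrow> complex) \<Rightarrow> (complex \<Rightarrow> complex) \<Rightarrow> complex set" where
  "sense_preserving_region H G = {z. cmod (deriv H z) > cmod (deriv G z)}"

definition sense_reversing_region :: "(complex \<Rightarrow> complex) \<Rightarrow> (complex \<Rightarrow> complex) \<Rightarrow> complex set" where
  "sense_reversing_region H G = {z. cmod (deriv H z) < cmod (deriv G z)}"

text \<open>The order is meaningful only for zeros in one of the two regions; the value \<open>0\<close> on
  the set where \<open>cmod (deriv H z) = cmod (deriv G z)\<close> is a dummy.\<close>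

definition zero_order :: "(complex \<Rightarrow> complex) \<Rightarrow> (complex \<Rightarrow> complex) \<Rightarrow> complex \<Rightarrow> int" where
  "zero_order H G z =
     (if z \<in> sense_preserving_region H G then int (LEAST m. m \<ge> 1 \<and> (deriv ^^ m) H z \<noteq> 0)
      else if z \<in> sense_reversing_region H G then - int (LEAST m. m \<ge> 1 \<and> (deriv ^^ m) G z \<noteq> 0)
      else 0)"

definition zero_mult :: "(complex \<Rightarrow> complex) \<Rightarrow> (complex \<Rightarrow> complex) \<Rightarrow> complex \<Rightarrow> nat" where
  "zero_mult H G z = nat \<bar>zero_order H G z\<bar>"

text \<open>Since multiplicities are undefined for zeros outside both regions, having exactly \<open>N\<close> zeros
  counted with multiplicity includes that there are no such zeros. Finiteness is
  required because \<open>sum\<close> is \<open>0\<close> on infinite sets.\<close>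

definition has_exactly_zeros ::
  "(complex \<Rightarrow> complex) \<Rightarrow> (complex \<Rightarrow> complex) \<Rightarrow> (complex \<Rightarrow> complex) \<Rightarrow> nat \<Rightarrow> bool" where
  "has_exactly_zeros f H G N \<longleftrightarrow>
     (\<forall>z. f z = H z + cnj (G z)) \<and>
     finite {z. f z = 0} \<and>
     {z. f z = 0} \<subseteq> sense_preserving_region H G \<union> sense_reversing_region H G \<and>
     (\<Sum>z | f z = 0. zero_mult H G z) = N"

definition analytic_part :: "nat \<Rightarrow> nat \<Rightarrow> real \<Rightarrow> complex \<Rightarrow> complex" where
  "analytic_part n k a z = z ^ n + of_real a * z ^ k - 1"

text \<open>This is \<open>G\<close> itself; the co-analytic part of the function is its conjugate.\<close>

definition coanalytic_part :: "nat \<Rightarrow> real \<Rightarrow> complex \<Rightarrow> complex" where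
  "coanalytic_part k b z = of_real b * z ^ k"

lemma analytic_part_plus_cnj_coanalytic_part:
  "z ^ n + of_real a * z ^ k + of_real b * cnj z ^ k - 1 =
     analytic_part n k a z + cnj (coanalytic_part k b z)"
  by (simp add: analytic_part_def coanalytic_part_def)

end

theory Submission
  imports Defs "HOL-Computational_Algebra.Fundamental_Theorem_Algebra"
begin

text \<open>Replace \<open>b\<close> by \<open>t * b\<close> and let \<open>t\<close> run from \<open>0\<close> to \<open>1\<close>. If \<open>a\<close> is large, then throughout
  this homotopy the zeros stay bounded and in the sense-preserving region. There the map
  \<open>z \<mapsto> z - f z / H' z\<^sub>0\<close> is a contraction near a zero \<open>z\<^sub>0\<close>, so zeros are isolated, simple, and
  persist uniquely under small changes of \<open>t\<close>; hence their number is constant. At \<open>t = 0\<close> it is the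
  number of zeros of a squarefree polynomial of degree \<open>n\<close>.\<close>

section \<open>Isolation and persistence of sense-preserving zeros\<close>

text \<open>Banach's fixed point theorem applies to \<open>T z = z - f t z / \<alpha>\<close> with
  \<open>\<alpha> = deriv H z\<^sub>0\<close>: near \<open>z\<^sub>0\<close> and for
  \<open>t\<close> near \<open>t\<^sub>0\<close> its derivative has norm close to at most
  \<open>\<bar>t\<^sub>0\<bar> * cmod (deriv G z\<^sub>0) / cmod \<alpha> < 1\<close>. The radius
  \<rho> is quantified before \<open>t\<close>, so that one radius can later serve finitely many
  zeros at once.\<close>

lemma eventually_unique_zero_near_sense_preserving_zero:
  fixes H G :: "complex \<Rightarrow> complex" and t\<^sub>0 :: real
  assumes H: "H holomorphic_on UNIV" and G: "G holomorphic_on UNIV"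
    and zero: "H z\<^sub>0 + of_real t\<^sub>0 * cnj (G z\<^sub>0) = 0"
    and sp: "\<bar>t\<^sub>0\<bar> * cmod (deriv G z\<^sub>0) < cmod (deriv H z\<^sub>0)"
  shows "\<forall>\<^sub>F \<rho> in at_right 0. \<forall>\<^sub>F t in nhds t\<^sub>0.
           \<exists>!z. z \<in> cball z\<^sub>0 \<rho> \<and> H z + of_real t * cnj (G z) = 0"
proof -
  define \<alpha> where "\<alpha> = deriv H z\<^sub>0"
  define f where "f = (\<lambda>t z. H z + of_real t * cnj (G z))"
  have \<alpha>: "cmod \<alpha> > 0" "\<alpha> \<noteq> 0"
    using order.strict_trans1[OF _ sp, of 0] by (simp_all add: \<alpha>_def)
  have DH: "(H has_field_derivative deriv H z) (at z within A)" for z A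
    using holomorphic_derivI[OF H open_UNIV] by blast
  have DG: "(G has_field_derivative deriv G z) (at z within A)" for z A
    using holomorphic_derivI[OF G open_UNIV] by blast
  have "\<bar>t\<^sub>0\<bar> * cmod (deriv G z\<^sub>0) / cmod \<alpha> < 1"
    using sp \<alpha> by (simp add: \<alpha>_def)
  \<comment> \<open>The contraction constant is chosen strictly above the ratio at
    \<open>z\<^sub>0\<close>, so that it survives small changes of \<open>t\<close> and
    \<open>z\<close>.\<close>
  then obtain q where q: "\<bar>t\<^sub>0\<bar> * cmod (deriv G z\<^sub>0) / cmod \<alpha> < q" "q < 1"
    using dense by blast
  have "0 \<le> \<bar>t\<^sub>0\<bar> * cmod (deriv G z\<^sub>0) / cmod \<alpha>" by simp
  then have q0: "0 < q" using q by linarith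
  have cont: "isCont (deriv H) z\<^sub>0" "isCont (deriv G) z\<^sub>0"
    using holomorphic_deriv[OF H open_UNIV] holomorphic_deriv[OF G open_UNIV]
    by (meson UNIV_I continuous_on_eq_continuous_at holomorphic_on_imp_continuous_on open_UNIV)+
  have "((\<lambda>(t, z). cmod (\<alpha> - deriv H z) + \<bar>t\<bar> * cmod (deriv G z)) \<longlongrightarrow>
          cmod (\<alpha> - deriv H z\<^sub>0) + \<bar>t\<^sub>0\<bar> * cmod (deriv G z\<^sub>0)) (nhds t\<^sub>0 \<times>\<^sub>F nhds z\<^sub>0)"
    unfolding case_prod_beta
    by (intro tendsto_intros isCont_tendsto_compose[OF cont(1)] isCont_tendsto_compose[OF cont(2)])
      (auto intro: filterlim_fst filterlim_snd)
  moreover have "cmod (\<alpha> - deriv H z\<^sub>0) + \<bar>t\<^sub>0\<bar> * cmod (deriv G z\<^sub>0) < q * cmod \<alpha>"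
    using q \<alpha> by (simp add: \<alpha>_def field_simps)
  ultimately have "\<forall>\<^sub>F (t, z) in nhds t\<^sub>0 \<times>\<^sub>F nhds z\<^sub>0.
      cmod (\<alpha> - deriv H z) + \<bar>t\<bar> * cmod (deriv G z) < q * cmod \<alpha>"
    unfolding case_prod_beta by (rule order_tendstoD(2))
  \<comment> \<open>Splitting the product neighbourhood makes the radius \<open>e\<close>
    independent of \<open>t\<close>.\<close>
  then obtain P Q where P: "\<forall>\<^sub>F t in nhds t\<^sub>0. P t" and Q: "\<forall>\<^sub>F z in nhds z\<^sub>0. Q z"
    and PQ: "\<And>t z. P t \<Longrightarrow> Q z \<Longrightarrow> cmod (\<alpha> - deriv H z) + \<bar>t\<bar> * cmod (deriv G z) < q * cmod \<alpha>"
    unfolding eventually_prod_filter by auto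
  from Q obtain e where e: "e > 0" "\<And>z. dist z z\<^sub>0 < e \<Longrightarrow> Q z"
    unfolding eventually_nhds_metric by blast
  have "\<forall>\<^sub>F t in nhds t\<^sub>0. \<exists>!z. z \<in> cball z\<^sub>0 \<rho> \<and> f t z = 0" if \<rho>: "0 < \<rho>" "\<rho> < e" for \<rho>
  proof -
    have "((\<lambda>t. cmod (f t z\<^sub>0)) \<longlongrightarrow> cmod (f t\<^sub>0 z\<^sub>0)) (nhds t\<^sub>0)"
      unfolding f_def by (intro tendsto_intros filterlim_ident)
    \<comment> \<open>The bound lets \<open>T\<close> move the centre by at most
      \<open>(1 - q) * \<rho>\<close>. Contraction by \<open>q\<close> contributes at most
      \<open>q * \<rho>\<close>, so \<open>T\<close> maps the closed ball into itself.\<close>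
    moreover have "cmod (f t\<^sub>0 z\<^sub>0) < (1 - q) * \<rho> * cmod \<alpha>"
      using zero q \<rho> \<alpha> by (simp add: f_def)
    ultimately have "\<forall>\<^sub>F t in nhds t\<^sub>0. cmod (f t z\<^sub>0) < (1 - q) * \<rho> * cmod \<alpha>"
      using order_tendstoD(2) by blast
    with P show ?thesis
    proof eventually_elim
      case (elim t)
      define T where "T = (\<lambda>z. z - f t z / \<alpha>)"
      have lip: "dist (T z) (T w) \<le> q * dist z w" if zw: "z \<in> cball z\<^sub>0 \<rho>" "w \<in> cball z\<^sub>0 \<rho>" for z w
      proof -
        have "cmod (T z - T w) \<le> q * cmod (z - w)"
        proof (rule differentiable_bound[OF convex_cball _ _ zw])
          fix x assume x: "x \<in> cball z\<^sub>0 \<rho>"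
          \<comment> \<open>Conjugation makes \<open>T'\<close> only real-linear, hence a Frechet
            derivative and its operator norm instead of a complex derivative.\<close>
          define T' where
            "T' = (\<lambda>h. h - (deriv H x * h + of_real t * cnj (deriv G x * h)) / \<alpha>)"
          have "(T has_derivative T') (at x)"
            unfolding T_def T'_def f_def
            by (intro has_derivative_diff has_derivative_ident has_derivative_add
                bounded_linear.has_derivative[OF bounded_linear_divide]
                has_derivative_mult_right has_derivative_cnj
                has_field_derivative_imp_has_derivative DH DG)
          then show "(T has_derivative T') (at x within cball z\<^sub>0 \<rho>)"
            by (rule has_derivative_at_withinI)
          show "onorm T' \<le> q"
          proof (rule onorm_le)
            fix h
            have "\<alpha> * T' h = (\<alpha> - deriv H x) * h - of_real t * cnj (deriv G x * h)"
              using \<alpha> by (simp add: T'_def field_simps)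
            then have "cmod (\<alpha> * T' h) \<le>
                cmod ((\<alpha> - deriv H x) * h) + cmod (of_real t * cnj (deriv G x * h))"
              by (simp only: norm_triangle_ineq4)
            then have "cmod \<alpha> * cmod (T' h) \<le>
                (cmod (\<alpha> - deriv H x) + \<bar>t\<bar> * cmod (deriv G x)) * cmod h"
              by (simp add: norm_mult distrib_right mult.assoc)
            also have "\<dots> \<le> (q * cmod \<alpha>) * cmod h"
              using PQ[OF elim(1) e(2)] x \<rho>
              by (intro mult_right_mono) (force simp: dist_commute less_imp_le)+
            finally show "cmod (T' h) \<le> q * cmod h"
              using \<alpha> by (simp add: mult_ac)
          qed
        qed
        then show ?thesis by (simp add: dist_norm)
      qed
      have self: "T z \<in> cball z\<^sub>0 \<rho>" if z: "z \<in> cball z\<^sub>0 \<rho>" for z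
      proof -
        have "dist (T z\<^sub>0) z\<^sub>0 = cmod (f t z\<^sub>0) / cmod \<alpha>"
          by (simp add: T_def dist_norm norm_divide)
        also have "\<dots> \<le> (1 - q) * \<rho>"
          using elim \<alpha> by (simp add: field_simps)
        finally have "dist (T z\<^sub>0) z\<^sub>0 \<le> (1 - q) * \<rho>" .
        moreover have "dist (T z) (T z\<^sub>0) \<le> q * \<rho>"
          using lip[OF z, of z\<^sub>0] z \<rho> q0
          by (smt (verit) dist_commute mem_cball mult_left_mono centre_in_cball)
        ultimately show ?thesis
          using dist_triangle[of "T z" z\<^sub>0 "T z\<^sub>0"] by (simp add: dist_commute algebra_simps)
      qed
      have "\<exists>!z. z \<in> cball z\<^sub>0 \<rho> \<and> T z = z"
      proof (rule Banach_fix)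
        show "complete (cball z\<^sub>0 \<rho>)" by (simp add: compact_imp_complete)
        show "cball z\<^sub>0 \<rho> \<noteq> {}" "0 \<le> q" "q < 1" using \<rho> q0 q by auto
      qed (use self lip in auto)
      then show ?case using \<alpha> by (simp add: T_def)
    qed
  qed
  then show ?thesis
    using e(1) unfolding f_def eventually_at_right_field by blast
qed

text \<open>An infinite subset of a compact set has a limit point in that set. The zero set is
  compact, and local uniqueness, read at the fixed parameter \<open>t\<close> itself, rules out
  limit points.\<close>

lemma finite_sense_preserving_zeros:
  fixes H G :: "complex \<Rightarrow> complex" and t :: real
  assumes H: "H holomorphic_on UNIV" and G: "G holomorphic_on UNIV"
    and bdd: "bounded {z. H z + of_real t * cnj (G z) = 0}"
    and sp: "\<And>z. H z + of_real t * cnj (G z) = 0 \<Longrightarrow> \<bar>t\<bar> * cmod (deriv G z) < cmod (deriv H z)"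
  shows "finite {z. H z + of_real t * cnj (G z) = 0}" (is "finite ?Z")
proof -
  have "closed ?Z"
    using holomorphic_on_imp_continuous_on[OF H] holomorphic_on_imp_continuous_on[OF G]
    by (intro closed_Collect_eq continuous_intros)
  then have "compact ?Z"
    using bdd compact_eq_bounded_closed by blast
  moreover have "\<not> z\<^sub>0 islimpt ?Z" if "z\<^sub>0 \<in> ?Z" for z\<^sub>0
  proof -
    from that have z0: "H z\<^sub>0 + of_real t * cnj (G z\<^sub>0) = 0" by simp
    have "\<forall>\<^sub>F \<rho> in at_right 0. \<exists>!z. z \<in> cball z\<^sub>0 \<rho> \<and> H z + of_real t * cnj (G z) = 0"
      using eventually_unique_zero_near_sense_preserving_zero[OF H G z0 sp[OF z0]]
      by eventually_elim (rule eventually_nhds_x_imp_x)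
    then obtain \<rho> where \<rho>: "0 < \<rho>"
      and uniq: "\<exists>!z. z \<in> cball z\<^sub>0 \<rho> \<and> H z + of_real t * cnj (G z) = 0"
      unfolding eventually_at_right_field by (metis dense)
    have "z = z\<^sub>0" if "z \<in> ?Z" "dist z z\<^sub>0 < \<rho>" for z
    proof -
      have "z \<in> cball z\<^sub>0 \<rho>" "z\<^sub>0 \<in> cball z\<^sub>0 \<rho>"
        using that(2) \<rho> by (simp_all add: dist_commute)
      then show ?thesis using uniq that(1) z0 by blast
    qed
    then show ?thesis
      using \<rho> unfolding islimpt_approachable by blast
  qed
  ultimately show ?thesis
    using finite_not_islimpt_in_compact[of ?Z ?Z] by simp
qed

section \<open>Constancy of the number of zeros along the homotopy\<close>

text \<open>Small disjoint balls around the zeros at \<open>t\<^sub>0\<close> each contain exactly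
  one zero at a nearby \<open>t\<close>, and the compact rest of \<open>cball 0 R\<close> contains
  none. The radius \<open>R\<close> is common to all \<open>t \<in> S\<close>, so no zero can enter
  from infinity.\<close>

lemma eventually_card_zeros_eq:
  fixes H G :: "complex \<Rightarrow> complex" and t\<^sub>0 :: real
  defines "Z \<equiv> \<lambda>t. {z. H z + of_real t * cnj (G z) = 0}"
  assumes H: "H holomorphic_on UNIV" and G: "G holomorphic_on UNIV"
    and bdd: "\<And>t. t \<in> S \<Longrightarrow> Z t \<subseteq> cball 0 R"
    and sp: "\<And>z. z \<in> Z t\<^sub>0 \<Longrightarrow> \<bar>t\<^sub>0\<bar> * cmod (deriv G z) < cmod (deriv H z)"
    and t0: "t\<^sub>0 \<in> S"
  shows "\<forall>\<^sub>F t in at t\<^sub>0 within S. card (Z t\<^sub>0) = card (Z t)"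
proof -
  have contH: "continuous_on A H" and contG: "continuous_on A G" for A
    using H G holomorphic_on_imp_continuous_on continuous_on_subset by blast+
  have "bounded (Z t\<^sub>0)"
    using bdd[OF t0] bounded_cball bounded_subset by blast
  then have fin: "finite (Z t\<^sub>0)"
    using finite_sense_preserving_zeros[OF H G] sp by (simp add: Z_def)
  have "\<forall>\<^sub>F \<rho> in at_right 0. \<forall>z\<in>Z t\<^sub>0. \<forall>\<^sub>F t in nhds t\<^sub>0. \<exists>!w. w \<in> cball z \<rho> \<and> w \<in> Z t"
    using eventually_unique_zero_near_sense_preserving_zero[OF H G _ sp]
    by (intro eventually_ball_finite[OF fin] ballI) (simp add: Z_def)
  \<comment> \<open>This separation makes the closed balls of radius \<rho> disjoint, which later
    gives injectivity of \<open>g\<close>.\<close>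
  moreover have "\<forall>\<^sub>F \<rho> in at_right 0. \<forall>z\<in>Z t\<^sub>0. \<forall>w\<in>Z t\<^sub>0. z \<noteq> w \<longrightarrow> 2 * \<rho> < dist z w"
  proof (intro eventually_ball_finite[OF fin] ballI)
    fix z w
    show "\<forall>\<^sub>F \<rho> in at_right 0. z \<noteq> w \<longrightarrow> 2 * \<rho> < dist z w"
    proof (cases "z = w")
      case False
      then show ?thesis
        unfolding eventually_at_right_field by (intro exI[of _ "dist z w / 2"]) auto
    qed simp
  qed
  moreover have "\<forall>\<^sub>F \<rho> in at_right 0. 0 < (\<rho>::real)"
    by (rule eventually_at_right_less)
  ultimately have "\<forall>\<^sub>F \<rho> in at_right 0. 0 < \<rho> \<and>
      (\<forall>z\<in>Z t\<^sub>0. \<forall>\<^sub>F t in nhds t\<^sub>0. \<exists>!w. w \<in> cball z \<rho> \<and> w \<in> Z t) \<and>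
      (\<forall>z\<in>Z t\<^sub>0. \<forall>w\<in>Z t\<^sub>0. z \<noteq> w \<longrightarrow> 2 * \<rho> < dist z w)"
    by eventually_elim blast
  then obtain \<rho> where \<rho>: "0 < \<rho>"
    and uniq: "\<And>z. z \<in> Z t\<^sub>0 \<Longrightarrow> \<forall>\<^sub>F t in nhds t\<^sub>0. \<exists>!w. w \<in> cball z \<rho> \<and> w \<in> Z t"
    and sep: "\<And>z w. z \<in> Z t\<^sub>0 \<Longrightarrow> w \<in> Z t\<^sub>0 \<Longrightarrow> z \<noteq> w \<Longrightarrow> 2 * \<rho> < dist z w"
    using eventually_happens'[OF trivial_limit_at_right_real] by blast

  \<comment> \<open>Open balls are removed so that \<open>K\<close> stays compact; uniqueness is
    available on the larger closed balls.\<close>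
  define K where "K = cball 0 R - (\<Union>z\<in>Z t\<^sub>0. ball z \<rho>)"
  have "compact K"
    unfolding K_def by (intro compact_diff compact_cball open_UN ballI open_ball)
  have "\<forall>\<^sub>F t in nhds t\<^sub>0. K \<inter> Z t = {}"
  proof -
    define m where "m = (\<lambda>t z. cmod (H z + of_real t * cnj (G z)))"
    have pos: "0 < m t\<^sub>0 z" if "z \<in> K" for z
      using that \<rho> by (force simp: K_def m_def Z_def)
    obtain \<mu> where \<mu>: "0 < \<mu>" "\<And>z. z \<in> K \<Longrightarrow> \<mu> \<le> m t\<^sub>0 z"
    proof (cases "K = {}")
      case False
      have "continuous_on K (m t\<^sub>0)"
        unfolding m_def by (intro continuous_intros contH contG)
      from continuous_attains_inf[OF \<open>compact K\<close> False this] show ?thesis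
        using pos that by metis
    qed (use that[of 1] in simp)
    obtain B where B: "0 < B" "\<And>z. z \<in> K \<Longrightarrow> cmod (G z) \<le> B"
      using compact_imp_bounded[OF compact_continuous_image[OF contG \<open>compact K\<close>]]
      unfolding bounded_pos by blast
    have "\<forall>\<^sub>F t in nhds t\<^sub>0. dist t t\<^sub>0 < \<mu> / B"
      using \<mu> B by (intro eventually_nhds_metric[THEN iffD2]) (auto intro!: exI[of _ "\<mu> / B"])
    then show ?thesis
    proof eventually_elim
      case (elim t)
      \<comment> \<open>At a zero for \<open>t\<close>, the value for \<open>t\<^sub>0\<close> has
        modulus \<open>\<bar>t\<^sub>0 - t\<bar> * cmod (G z)\<close>, which on \<open>K\<close> is
        less than \<open>(\<mu> / B) * B = \<mu>\<close>, against the choice of \<mu>.\<close>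
      have "z \<notin> Z t" if z: "z \<in> K" for z
      proof
        assume "z \<in> Z t"
        then have "H z + of_real t\<^sub>0 * cnj (G z) = of_real (t\<^sub>0 - t) * cnj (G z)"
          by (simp add: Z_def algebra_simps add_eq_0_iff)
        then have "m t\<^sub>0 z = \<bar>t\<^sub>0 - t\<bar> * cmod (G z)"
          unfolding m_def by (metis complex_mod_cnj norm_mult norm_of_real)
        also have "\<dots> \<le> \<bar>t\<^sub>0 - t\<bar> * B"
          using B(2)[OF z] by (intro mult_left_mono) auto
        also have "\<dots> < \<mu>"
          using elim B by (simp add: dist_real_def field_simps abs_minus_commute)
        finally show False using \<mu>(2)[OF z] by simp
      qed
      then show ?case by blast
    qed
  qed
  moreover have "\<forall>\<^sub>F t in nhds t\<^sub>0. \<forall>z\<in>Z t\<^sub>0. \<exists>!w. w \<in> cball z \<rho> \<and> w \<in> Z t"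
    using uniq by (intro eventually_ball_finite[OF fin]) blast
  ultimately have "\<forall>\<^sub>F t in nhds t\<^sub>0. t \<in> S \<longrightarrow> card (Z t\<^sub>0) = card (Z t)"
  proof eventually_elim
    case (elim t)
    define g where "g = (\<lambda>z. THE w. w \<in> cball z \<rho> \<and> w \<in> Z t)"
    have g: "g z \<in> cball z \<rho>" "g z \<in> Z t" if "z \<in> Z t\<^sub>0" for z
      using theI'[OF elim(2)[rule_format, OF that]] by (auto simp: g_def)
    show ?case
    proof
      assume t: "t \<in> S"
      have "bij_betw g (Z t\<^sub>0) (Z t)"
        unfolding bij_betw_def
      proof
        show "inj_on g (Z t\<^sub>0)"
        proof (rule inj_onI, rule ccontr)
          fix z w assume zw: "z \<in> Z t\<^sub>0" "w \<in> Z t\<^sub>0" "g z = g w" "z \<noteq> w"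
          then have "dist z w \<le> 2 * \<rho>"
            using dist_triangle2[of z w "g z"] g(1)[of z] g(1)[of w] by simp
          then show False using sep[OF zw(1,2,4)] by simp
        qed
        show "g ` Z t\<^sub>0 = Z t"
        proof
          show "Z t \<subseteq> g ` Z t\<^sub>0"
          proof
            \<comment> \<open>Since \<open>w\<close> lies in \<open>cball 0 R\<close> but not in
              \<open>K\<close>, it lies in one of the balls, where uniqueness identifies it with the
              value of \<open>g\<close>.\<close>
            fix w assume w: "w \<in> Z t"
            then have "w \<notin> K" "w \<in> cball 0 R"
              using elim(1) bdd[OF t] by blast+
            then obtain z where z: "z \<in> Z t\<^sub>0" "w \<in> cball z \<rho>"
              unfolding K_def by force
            then have "w = g z"
              using elim(2) g[OF z(1)] w by blast
            with z show "w \<in> g ` Z t\<^sub>0" by blast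
          qed
        qed (use g in blast)
      qed
      then show "card (Z t\<^sub>0) = card (Z t)" by (rule bij_betw_same_card)
    qed
  qed
  then show ?thesis
    unfolding eventually_at_filter by eventually_elim blast
qed

text \<open>The number of zeros is locally constant in \<open>t\<close> on the connected interval
  \<open>{0..1}\<close>. Boundedness is required of the union of all the zero sets, which supplies
  the common radius \<open>R\<close>.\<close>

lemma card_zeros_sense_preserving_homotopy:
  fixes H G :: "complex \<Rightarrow> complex"
  assumes "H holomorphic_on UNIV" and "G holomorphic_on UNIV"
    and bdd: "bounded {z. \<exists>t\<in>{0..1}. H z + of_real t * cnj (G z) = 0}"
    and sp: "\<And>t z. t \<in> {0..1} \<Longrightarrow> H z + of_real t * cnj (G z) = 0 \<Longrightarrow>
               t * cmod (deriv G z) < cmod (deriv H z)"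
  shows "card {z. H z + cnj (G z) = 0} = card {z. H z = 0}"
proof -
  obtain R where R: "{z. \<exists>t\<in>{0..1}. H z + of_real t * cnj (G z) = 0} \<subseteq> cball 0 R"
    using bounded_subset_ballD[OF bdd] ball_subset_cball by (meson subset_trans)
  define N where "N = (\<lambda>t::real. card {z. H z + of_real t * cnj (G z) = 0})"
  have "N 1 = N 0"
  proof (rule connected_local_const[where f = N and A = "{0..1}"])
    show "connected {0..1::real}" by simp
    show "\<forall>s\<in>{0..1}. \<forall>\<^sub>F t in at s within {0..1}. N s = N t"
    proof
      fix s :: real assume s: "s \<in> {0..1}"
      show "\<forall>\<^sub>F t in at s within {0..1}. N s = N t"
        unfolding N_def
      proof (rule eventually_card_zeros_eq[where S = "{0..1}" and R = R, OF assms(1,2) _ _ s])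
        show "{z. H z + of_real t * cnj (G z) = 0} \<subseteq> cball 0 R" if "t \<in> {0..1}" for t
          using R that by blast
        show "\<bar>s\<bar> * cmod (deriv G z) < cmod (deriv H z)"
          if "z \<in> {z. H z + of_real s * cnj (G z) = 0}" for z
          using sp[OF s] s that by simp
      qed
    qed
  qed simp_all
  then show ?thesis by (simp add: N_def)
qed

section \<open>Estimates for the trinomial\<close>

text \<open>If \<open>r = cmod z > A + 1\<close>, then
  \<open>A * r ^ k + 1 \<le> (A + 1) * r ^ (n - 1) < r ^ n\<close>.\<close>

lemma bounded_trinomial_zeros:
  fixes k n :: nat and A :: real
  assumes "k < n" and "0 \<le> A"
  shows "bounded {z::complex. cmod z ^ n \<le> A * cmod z ^ k + 1}"
proof (rule boundedI)
  fix z :: complex assume "z \<in> {z. cmod z ^ n \<le> A * cmod z ^ k + 1}"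
  then have z: "cmod z ^ n \<le> A * cmod z ^ k + 1" by simp
  show "cmod z \<le> A + 1"
  proof (rule ccontr)
    assume "\<not> cmod z \<le> A + 1"
    then have r: "A + 1 < cmod z" "1 < cmod z" using assms(2) by auto
    have "A * cmod z ^ k + 1 \<le> A * cmod z ^ (n - 1) + cmod z ^ (n - 1)"
      using assms r by (intro add_mono mult_left_mono power_increasing one_le_power) auto
    also have "\<dots> = (A + 1) * cmod z ^ (n - 1)" by (simp add: algebra_simps)
    also have "\<dots> < cmod z * cmod z ^ (n - 1)"
      using r by (intro mult_strict_right_mono zero_less_power) linarith+
    also have "\<dots> = cmod z ^ n" using assms(1) by (simp flip: power_Suc)
    finally show False using z by simp
  qed
qed

lemma analytic_part_eq_poly:
  "analytic_part n k a z = poly (monom 1 n + monom (of_real a) k - 1) z"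
  by (simp add: analytic_part_def poly_monom)

lemma deriv_analytic_part:
  "deriv (analytic_part n k a) z =
     of_nat n * z ^ (n - 1) + of_real a * of_nat k * z ^ (k - 1)"
  unfolding analytic_part_def
  by (rule DERIV_imp_deriv) (auto intro!: derivative_eq_intros)

lemma deriv_coanalytic_part:
  "deriv (coanalytic_part k b) z = of_real b * of_nat k * z ^ (k - 1)"
  unfolding coanalytic_part_def
  by (rule DERIV_imp_deriv) (auto intro!: derivative_eq_intros)

lemma sense_preserving_at_trinomial_zero:
  fixes n k :: nat and a b \<epsilon> :: real and z :: complex
  assumes kn: "k < n" and k: "1 \<le> k" and \<epsilon>: "0 < \<epsilon>"
    and a: "real n / \<epsilon> < a" and b0: "0 \<le> b"
    and b: "b \<le> ((real n - real k) / (real n + real k) - \<epsilon>) * a"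
    and zero: "analytic_part n k a z + cnj (coanalytic_part k b z) = 0"
  shows "cmod (deriv (coanalytic_part k b) z) < cmod (deriv (analytic_part n k a) z)"
proof -
  define w where "w = of_nat n * z ^ (n - k) + of_real (a * real k)"
  have \<epsilon>a: "real n < \<epsilon> * a" using a \<epsilon> by (simp add: field_simps)
  have a0: "0 < a" using a \<epsilon> by (smt (verit) divide_nonneg_pos of_nat_0_le_iff)
  have "(real n + real k) * b \<le> (real n + real k) * (((real n - real k) / (real n + real k) - \<epsilon>) * a)"
    using b by (rule mult_left_mono) simp
  also have "\<dots> = (real n - real k) * a - (real n + real k) * (\<epsilon> * a)"
    using kn by (simp add: field_simps)
  finally have nkb: "(real n + real k) * b \<le> (real n - real k) * a - (real n + real k) * (\<epsilon> * a)" .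
  \<comment> \<open>At \<open>0\<close> the function has the value \<open>-1\<close>. This point
    must be excluded, since both derivatives vanish there when \<open>k > 1\<close>.\<close>
  have "z \<noteq> 0" using zero kn k by (auto simp: analytic_part_def coanalytic_part_def power_0_left)
  have pow: "z ^ (n - k) * z ^ k = z ^ n" using kn by (simp flip: power_add)
  have powd: "z ^ (n - k) * z ^ (k - 1) = z ^ (n - 1)" using kn k by (simp flip: power_add)
  have "b * real k < cmod w"
  proof (cases "1 \<le> cmod z")
    case True
    have "w * z ^ k = of_nat n * (z ^ n + of_real a * z ^ k) - of_real ((real n - real k) * a) * z ^ k"
      using pow by (simp add: w_def algebra_simps)
    also have "z ^ n + of_real a * z ^ k = 1 - of_real b * cnj z ^ k"
      using zero by (simp add: analytic_part_def coanalytic_part_def algebra_simps)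
    finally have "of_real ((real n - real k) * a) * z ^ k =
        of_nat n - of_nat n * of_real b * cnj z ^ k - w * z ^ k"
      by (simp add: algebra_simps)
    then have "cmod (of_real ((real n - real k) * a) * z ^ k) \<le>
        cmod (of_nat n) + cmod (of_nat n * of_real b * cnj z ^ k) + cmod (w * z ^ k)"
      by (metis norm_triangle_ineq4 add_right_mono order_trans)
    then have "(real n - real k) * a * cmod z ^ k \<le>
        real n + real n * b * cmod z ^ k + cmod w * cmod z ^ k"
      using a0 b0 kn by (simp add: norm_mult norm_power abs_mult del: of_real_mult of_real_diff)
    \<comment> \<open>Here \<open>1 \<le> cmod z ^ k\<close> allows the constant \<open>n\<close> to
      share the factor \<open>cmod z ^ k\<close>, which then cancels.\<close>
    also have "\<dots> \<le> (real n + real n * b + cmod w) * cmod z ^ k"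
      using mult_left_mono[OF one_le_power[OF True, of k], of "real n"] by (simp add: algebra_simps)
    finally have "(real n - real k) * a \<le> real n + real n * b + cmod w"
      using \<open>z \<noteq> 0\<close> by simp
    moreover have "\<epsilon> * a \<le> (real n + real k) * (\<epsilon> * a)"
      using \<epsilon>a kn mult_right_mono[of 1 "real n + real k" "\<epsilon> * a"] by simp
    ultimately show ?thesis
      using nkb \<epsilon>a by (simp add: algebra_simps)
  next
    case False
    have "cmod (of_real (a * real k)) \<le> cmod w + cmod (of_nat n * z ^ (n - k))"
      using norm_triangle_ineq4[of w "of_nat n * z ^ (n - k)"] by (simp add: w_def)
    also have "cmod (of_nat n * z ^ (n - k)) \<le> real n"
      using False by (simp add: norm_mult norm_power mult_left_le power_le_one)
    finally have "a * real k \<le> cmod w + real n"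
      using a0 by (simp add: norm_mult)
    \<comment> \<open>Only the weaker consequence \<open>b \<le> (1 - \<epsilon>) * a\<close> of the
      bound on \<open>b\<close> is needed in this case.\<close>
    moreover have "(real n - real k) * a \<le> (real n + real k) * a"
      using a0 by (intro mult_right_mono) auto
    then have "(real n + real k) * b \<le> (real n + real k) * (a - \<epsilon> * a)"
      unfolding right_diff_distrib using nkb by linarith
    then have "b \<le> a - \<epsilon> * a"
      using kn by simp
    then have "b * real k \<le> (a - \<epsilon> * a) * real k"
      by (rule mult_right_mono) simp
    moreover have "\<epsilon> * a \<le> \<epsilon> * a * real k"
      using \<epsilon>a k mult_left_mono[of 1 "real k" "\<epsilon> * a"] by simp
    ultimately show ?thesis
      using \<epsilon>a by (simp add: algebra_simps)
  qed
  then have "b * real k * cmod z ^ (k - 1) < cmod w * cmod z ^ (k - 1)"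
    using \<open>z \<noteq> 0\<close> by simp
  moreover have "deriv (analytic_part n k a) z = w * z ^ (k - 1)"
    using powd by (simp add: deriv_analytic_part w_def algebra_simps)
  ultimately show ?thesis
    using b0 by (simp add: deriv_coanalytic_part norm_mult norm_power)
qed

section \<open>Counting the zeros at \<open>t = 0\<close>\<close>

text \<open>Over the complex numbers the orders of the roots add up to the degree, and here every
  order is 1.\<close>

lemma card_roots_rsquarefree:
  fixes p :: "complex poly"
  assumes "rsquarefree p"
  shows "card {z. poly p z = 0} = degree p"
proof -
  have p: "p \<noteq> 0" using assms by (simp add: rsquarefree_def)
  have "degree p = (\<Sum>z | poly p z = 0. order z p)"
    using p by (simp flip: size_proots_complex add: size_multiset_overloaded_eq)
  also have "\<dots> = (\<Sum>z | poly p z = 0. 1)"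
    using assms by (intro sum.cong) (simp_all add: rsquarefree_root_order[OF assms _ p])
  finally show ?thesis by simp
qed

text \<open>Simplicity of the roots is assumed through the derivative because the sense-preserving
  inequality at \<open>t = 0\<close> delivers exactly that.\<close>

lemma card_zeros_analytic_part:
  assumes "k < n"
    and "\<And>z. analytic_part n k a z = 0 \<Longrightarrow> deriv (analytic_part n k a) z \<noteq> 0"
  shows "card {z. analytic_part n k a z = 0} = n"
proof -
  define p :: "complex poly" where "p = monom 1 n + monom (of_real a) k - 1"
  have p: "analytic_part n k a = poly p"
    by (simp add: fun_eq_iff p_def analytic_part_eq_poly)
  have "degree (monom (of_real a) k - 1 :: complex poly) < n"
    using assms(1) degree_monom_le[of "of_real a :: complex" k] by (intro degree_diff_less) auto
  then have "degree p = n"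
    by (simp add: p_def add_diff_eq[symmetric] degree_add_eq_left degree_monom_eq)
  moreover have "rsquarefree p"
    using assms(2) by (auto simp: p rsquarefree_roots DERIV_imp_deriv[OF poly_DERIV])
  ultimately show ?thesis
    using card_roots_rsquarefree by (simp add: p)
qed

section \<open>Multiplicities and the count for \<open>f\<close>\<close>

text \<open>The derivative of \<open>H\<close> is nonzero in this region, so the least admissible
  \<open>m\<close> is already 1. Counting with multiplicity thus reduces to cardinality.\<close>

lemma zero_mult_sense_preserving:
  assumes "z \<in> sense_preserving_region H G"
  shows "zero_mult H G z = 1"
proof -
  have "deriv H z \<noteq> 0"
    using assms by (auto simp: sense_preserving_region_def)
  then have "(LEAST m. m \<ge> 1 \<and> (deriv ^^ m) H z \<noteq> 0) = 1"
    by (intro Least_equality) auto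
  then show ?thesis
    using assms by (simp add: zero_mult_def zero_order_def)
qed

theorem theorem1p2:
  fixes n k :: nat and \<epsilon> :: real
  assumes "n > k" and "k \<ge> 1" and "\<epsilon> > 0"
  shows "\<exists>a\<^sub>0::real. \<forall>a>a\<^sub>0. a > 0 \<longrightarrow>
           (\<forall>b::real. 0 < b \<and> b < ((real n - real k) / (real n + real k) - \<epsilon>) * a \<longrightarrow>
              has_exactly_zeros
                (\<lambda>z. z ^ n + complex_of_real a * z ^ k + complex_of_real b * cnj z ^ k - 1)
                (analytic_part n k a) (coanalytic_part k b) n)"
\<comment> \<open>The witness is the threshold beyond which \<open>\<epsilon> * a\<close> exceeds
  \<open>n\<close>.\<close>
proof (intro exI[of _ "real n / \<epsilon>"] allI impI)
  fix a b :: real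
  assume a: "real n / \<epsilon> < a" "0 < a"
    and b: "0 < b \<and> b < ((real n - real k) / (real n + real k) - \<epsilon>) * a"
  define H where "H = analytic_part n k a"
  define G where "G = coanalytic_part k b"
  define f where "f = (\<lambda>z. H z + cnj (G z))"
  have hol: "H holomorphic_on UNIV" "G holomorphic_on UNIV"
    unfolding H_def G_def analytic_part_def[abs_def] coanalytic_part_def[abs_def]
    by (intro holomorphic_intros)+
  \<comment> \<open>Scaling the co-analytic part by \<open>t\<close> amounts to replacing
    \<open>b\<close> by \<open>t * b\<close>, which still satisfies the upper bound on
    \<open>b\<close>.\<close>
  have sp: "t * cmod (deriv G z) < cmod (deriv H z)"
    if t: "t \<in> {0..1}" and z: "H z + of_real t * cnj (G z) = 0" for t z
  proof -
    have "t * b \<le> b" using t b by (simp add: mult_left_le_one_le)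
    then have "t * b \<le> ((real n - real k) / (real n + real k) - \<epsilon>) * a" using b by linarith
    moreover have "analytic_part n k a z + cnj (coanalytic_part k (t * b) z) = 0"
      using z by (simp add: H_def G_def coanalytic_part_def mult.assoc)
    ultimately have "cmod (deriv (coanalytic_part k (t * b)) z) < cmod (deriv (analytic_part n k a) z)"
      using b t by (intro sense_preserving_at_trinomial_zero[OF assms a(1)]) auto
    then show ?thesis
      using t by (simp add: H_def G_def deriv_coanalytic_part norm_mult abs_mult mult.assoc)
  qed
  \<comment> \<open>Since \<open>t * b \<le> b\<close>, one trinomial inequality bounds the zeros
    for all \<open>t\<close> simultaneously.\<close>
  have "{z. \<exists>t\<in>{0..1}. H z + of_real t * cnj (G z) = 0} \<subseteq>
      {z. cmod z ^ n \<le> (a + b) * cmod z ^ k + 1}"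
  proof safe
    fix z and t :: real
    assume t: "t \<in> {0..1}" and z: "H z + of_real t * cnj (G z) = 0"
    then have "z ^ n = 1 - of_real a * z ^ k - of_real (t * b) * cnj z ^ k"
      by (simp add: H_def G_def analytic_part_def coanalytic_part_def algebra_simps add_eq_0_iff)
    then have "cmod (z ^ n) \<le> cmod 1 + cmod (of_real a * z ^ k) + cmod (of_real (t * b) * cnj z ^ k)"
      by (metis norm_triangle_ineq4 add_right_mono order_trans)
    also have "\<dots> = 1 + a * cmod z ^ k + t * b * cmod z ^ k"
      using a b t by (simp add: norm_mult norm_power abs_mult)
    also have "\<dots> \<le> 1 + a * cmod z ^ k + b * cmod z ^ k"
      using b t by (intro add_left_mono mult_right_mono) (auto simp: mult_left_le_one_le)
    finally show "cmod z ^ n \<le> (a + b) * cmod z ^ k + 1"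
      by (simp add: norm_power algebra_simps)
  qed
  then have bdd: "bounded {z. \<exists>t\<in>{0..1}. H z + of_real t * cnj (G z) = 0}"
    by (rule bounded_subset[rotated]) (use bounded_trinomial_zeros[OF assms(1), of "a + b"] a b in simp)
  have "{z. f z = 0} \<subseteq> {z. \<exists>t\<in>{0..1}. H z + of_real t * cnj (G z) = 0}"
    by (force simp: f_def intro: bexI[of _ 1])
  then have "bounded {z. f z = 0}"
    using bdd bounded_subset by blast
  then have "finite {z. f z = 0}"
    using finite_sense_preserving_zeros[OF hol, of 1] sp[of 1] by (simp add: f_def)
  moreover have preserving: "{z. f z = 0} \<subseteq> sense_preserving_region H G"
    using sp[of 1] by (auto simp: f_def sense_preserving_region_def)
  moreover have "card {z. f z = 0} = card {z. H z = 0}"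
    unfolding f_def using hol bdd sp by (rule card_zeros_sense_preserving_homotopy)
  \<comment> \<open>At \<open>t = 0\<close> the inequality \<open>sp\<close> says that
    \<open>deriv H\<close> is nonzero at every zero of \<open>H\<close>.\<close>
  moreover have "card {z. H z = 0} = n"
    using card_zeros_analytic_part[OF assms(1), of a] sp[of 0] by (force simp: H_def)
  moreover have "(\<Sum>z | f z = 0. zero_mult H G z) = (\<Sum>z | f z = 0. 1)"
    using preserving by (intro sum.cong zero_mult_sense_preserving) auto
  ultimately have "has_exactly_zeros f H G n"
    by (auto simp: has_exactly_zeros_def f_def)
  moreover have "f = (\<lambda>z. z ^ n + of_real a * z ^ k + of_real b * cnj z ^ k - 1)"
    by (simp add: fun_eq_iff f_def H_def G_def analytic_part_plus_cnj_coanalytic_part)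
  ultimately show "has_exactly_zeros
      (\<lambda>z. z ^ n + complex_of_real a * z ^ k + complex_of_real b * cnj z ^ k - 1)
      (analytic_part n k a) (coanalytic_part k b) n"
    by (simp add: H_def G_def)
qed

end
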